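(* For every $n\ge 1$ there is a wait-free implementation of a one-shot timestamp object, in an asynchronous shared memory system of $n$ processes communicating only through atomic multi-reader multi-writer read/write registers, that uses $2\lceil\sqrt{n}\,\rceil$ registers.
   Context: Model. There are $n$ processes with distinct identifiers, which communicate only via atomic read and write operations on shared registers; every process may read and write every register, and a register may hold arbitrary values. Processes are scheduled asynchronously: an execution is a sequence of steps, arbitrarily interleaved among processes, starting from the initial configuration. Timestamp object. A timestamp object supports two methods, $\mathrm{getTS}()$ and $\mathrm{compare}(t_1,t_2)$. $\mathrm{getTS}()$ outputs a timestamp from some (possibly infinite) universe $\mathcal{T}$; $\mathrm{compare}$ takes two timestamps and returns true or false. A method call $g_1$ happens before $g_2$, written $g_1\to g_2$, if the response of $g_1$ occurs before the invocation of $g_2$. The requirement is: if two $\mathrm{getTS}$ calls $g_1,g_2$ return $t_1,t_2$ respectively and $g_1\to g_2$, then any later call $\mathrm{compare}(t_1,t_2)$ returns true and any later call $\mathrm{compare}(t_2,t_1)$ returns false. The object is one-shot if each process is allowed to invoke $\mathrm{getTS}$ at most once (the number of $\mathrm{compare}$ calls is not restricted). An implementation is wait-free if, in every execution, every method call by a process finishes within a finite number of that process's own steps, regardless of the steps of other processes. *)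

theory Defs
  imports Complex_Main
begin

datatype 't call = GetTS | Compare 't 't

datatype 't result = Stamp 't | Truth bool

text \<open>
  A process is a deterministic automaton with local states of type \<open>'s\<close>. While it executes a
  call, its local state alone determines what it does next: read a register (and continue
  depending on the contents), write a register, or respond to the call. The local state after
  a response is kept, so a process may carry information from one call to the next.
\<close>

datatype ('s, 'v, 't) action =
    Read nat "'v \<Rightarrow> 's"
  | Write nat 'v 's
  | Return "'t result" 's

text \<open>
  The first argument of \<open>init_local\<close>, \<open>start\<close> and \<open>action\<close> is the identifier of the process.
  \<open>start\<close> gives the local state with which a call begins.
\<close>

record ('s, 'v, 't) implementation =
  universe :: "'t set"
  init_regs :: "nat \<Rightarrow> 'v"
  init_local :: "nat \<Rightarrow> 's"
  start :: "nat \<Rightarrow> 't call \<Rightarrow> 's \<Rightarrow> 's"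
  action :: "nat \<Rightarrow> 's \<Rightarrow> ('s, 'v, 't) action"

text \<open>
  The \<open>n\<close> processes have the identifiers \<open>0, \<dots>, n - 1\<close>, the \<open>m\<close> registers the
  indices \<open>0, \<dots>, m - 1\<close>.
\<close>

definition uses_registers :: "('s, 'v, 't) implementation \<Rightarrow> nat \<Rightarrow> nat \<Rightarrow> bool" where
  "uses_registers I n m \<longleftrightarrow>
    (\<forall>p < n. \<forall>s. case action I p s of
        Read r k \<Rightarrow> r < m
      | Write r v s' \<Rightarrow> r < m
      | Return x s' \<Rightarrow> True)"

record ('s, 'v) config =
  regs :: "nat \<Rightarrow> 'v"
  local :: "nat \<Rightarrow> 's"
  busy :: "nat \<Rightarrow> bool"  \<comment> \<open>the process has invoked a call that has not yet responded\<close>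

definition init_config :: "('s, 'v, 't) implementation \<Rightarrow> ('s, 'v) config" where
  "init_config I = \<lparr>regs = init_regs I, local = init_local I, busy = (\<lambda>p. False)\<rparr>"

text \<open>\<open>Access p\<close> is one atomic read or write by process \<open>p\<close>.\<close>

datatype 't event = Invoke nat "'t call" | Access nat | Respond nat "'t result"

fun proc :: "'t event \<Rightarrow> nat" where
  "proc (Invoke p c) = p"
| "proc (Access p) = p"
| "proc (Respond p x) = p"

fun legal_call :: "'t set \<Rightarrow> 't call \<Rightarrow> bool" where
  "legal_call T GetTS = True"
| "legal_call T (Compare t1 t2) = (t1 \<in> T \<and> t2 \<in> T)"

inductive step ::
  "('s, 'v, 't) implementation \<Rightarrow> nat \<Rightarrow> ('s, 'v) config \<Rightarrow> 't event \<Rightarrow> ('s, 'v) config \<Rightarrow> bool"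
  for I :: "('s, 'v, 't) implementation" and n :: nat where
  invoke_step: "p < n \<Longrightarrow> \<not> busy C p \<Longrightarrow> legal_call (universe I) c \<Longrightarrow>
    step I n C (Invoke p c)
      (C\<lparr>local := (local C)(p := start I p c (local C p)), busy := (busy C)(p := True)\<rparr>)"
| read_step: "p < n \<Longrightarrow> busy C p \<Longrightarrow> action I p (local C p) = Read r k \<Longrightarrow>
    step I n C (Access p) (C\<lparr>local := (local C)(p := k (regs C r))\<rparr>)"
| write_step: "p < n \<Longrightarrow> busy C p \<Longrightarrow> action I p (local C p) = Write r v s \<Longrightarrow>
    step I n C (Access p) (C\<lparr>regs := (regs C)(r := v), local := (local C)(p := s)\<rparr>)"
| respond_step: "p < n \<Longrightarrow> busy C p \<Longrightarrow> action I p (local C p) = Return x s \<Longrightarrow>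
    step I n C (Respond p x)
      (C\<lparr>local := (local C)(p := s), busy := (busy C)(p := False)\<rparr>)"

inductive run ::
  "('s, 'v, 't) implementation \<Rightarrow> nat \<Rightarrow> 't event list \<Rightarrow> ('s, 'v) config \<Rightarrow> bool"
  for I :: "('s, 'v, 't) implementation" and n :: nat where
  init: "run I n [] (init_config I)"
| step: "run I n es C \<Longrightarrow> step I n C e C' \<Longrightarrow> run I n (es @ [e]) C'"

definition one_shot :: "'t event list \<Rightarrow> bool" where
  "one_shot es \<longleftrightarrow>
    (\<forall>p i j. i < length es \<and> j < length es \<and> es ! i = Invoke p GetTS \<and> es ! j = Invoke p GetTS
      \<longrightarrow> i = j)"

definition one_shot_execution ::
  "('s, 'v, 't) implementation \<Rightarrow> nat \<Rightarrow> 't event list \<Rightarrow> bool" where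
  "one_shot_execution I n es \<longleftrightarrow> (\<exists>C. run I n es C) \<and> one_shot es"

definition infinite_one_shot_execution ::
  "('s, 'v, 't) implementation \<Rightarrow> nat \<Rightarrow> (nat \<Rightarrow> 't event) \<Rightarrow> bool" where
  "infinite_one_shot_execution I n \<sigma> \<longleftrightarrow> (\<forall>k. one_shot_execution I n (map \<sigma> [0..<k]))"

text \<open>
  \<open>completed_call es p c i x k\<close>: process \<open>p\<close> invokes \<open>c\<close> at position \<open>i\<close> of \<open>es\<close>, and this
  call responds with \<open>x\<close> at position \<open>k\<close>. Hence a call with response position \<open>k1\<close> happens
  before a call with invocation position \<open>i2\<close> iff \<open>k1 < i2\<close>.
\<close>

definition completed_call ::
  "'t event list \<Rightarrow> nat \<Rightarrow> 't call \<Rightarrow> nat \<Rightarrow> 't result \<Rightarrow> nat \<Rightarrow> bool" where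
  "completed_call es p c i x k \<longleftrightarrow>
    i < k \<and> k < length es \<and> es ! i = Invoke p c \<and> es ! k = Respond p x \<and>
    (\<forall>j y. i < j \<and> j < k \<longrightarrow> es ! j \<noteq> Respond p y)"

definition returns_proper_results :: "'t set \<Rightarrow> 't event list \<Rightarrow> bool" where
  "returns_proper_results T es \<longleftrightarrow>
    (\<forall>p i x k. completed_call es p GetTS i x k \<longrightarrow> (\<exists>t \<in> T. x = Stamp t)) \<and>
    (\<forall>p t1 t2 i x k. completed_call es p (Compare t1 t2) i x k \<longrightarrow> (\<exists>b. x = Truth b))"

text \<open>
  A \<open>compare\<close> call is later than the two \<open>getTS\<close> calls if it is invoked after the response of
  the second one (and hence also after that of the first one).
\<close>

definition respects_happens_before :: "'t event list \<Rightarrow> bool" where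
  "respects_happens_before es \<longleftrightarrow>
    (\<forall>p1 i1 t1 k1 p2 i2 t2 k2.
      completed_call es p1 GetTS i1 (Stamp t1) k1 \<and>
      completed_call es p2 GetTS i2 (Stamp t2) k2 \<and> k1 < i2 \<longrightarrow>
      (\<forall>q i x k. k2 < i \<and> completed_call es q (Compare t1 t2) i x k \<longrightarrow> x = Truth True) \<and>
      (\<forall>q i x k. k2 < i \<and> completed_call es q (Compare t2 t1) i x k \<longrightarrow> x = Truth False))"

definition implements_one_shot_timestamp ::
  "('s, 'v, 't) implementation \<Rightarrow> nat \<Rightarrow> bool" where
  "implements_one_shot_timestamp I n \<longleftrightarrow>
    (\<forall>es. one_shot_execution I n es \<longrightarrow>
      returns_proper_results (universe I) es \<and> respects_happens_before es)"

text \<open>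
  A busy process can always take a step, so a call can fail to finish within finitely many steps of its
  process only in an infinite execution in which that process takes infinitely many steps.
\<close>

definition wait_free :: "('s, 'v, 't) implementation \<Rightarrow> nat \<Rightarrow> bool" where
  "wait_free I n \<longleftrightarrow>
    (\<forall>\<sigma>. infinite_one_shot_execution I n \<sigma> \<longrightarrow>
      (\<forall>p c i. \<sigma> i = Invoke p c \<and> infinite {j. proc (\<sigma> j) = p} \<longrightarrow>
        (\<exists>k > i. \<exists>x. \<sigma> k = Respond p x)))"

text \<open>
  HOL cannot quantify existentially over types, so an existence statement has to fix the types
  of local states, register contents and timestamps. Natural numbers serve for all three:
  they encode every finite data structure, and \<open>universe\<close> selects the set of timestamps.
\<close>

type_synonym nat_implementation = "(nat, nat, nat) implementation"

end

theory Submission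
  imports Defs "HOL-Library.Countable"
begin

text \<open>
  Every process writes at most once, and what it writes carries its identifier, so a register never
  holds the same value twice. Phase \<open>k\<close> begins when register \<open>k - 1\<close> is first written; the value
  written there records the writers found in registers \<open>0, \<dots>, k - 2\<close> before the phase began.
  A \<open>getTS\<close> call of phase \<open>k\<close> overwrites some register \<open>j < k - 1\<close> that still agrees with this record,
  and opens phase \<open>k + 1\<close> if there is none.

  Several calls may open the same phase, each with its own record. Two views from one phase are
  therefore compared by the set of registers that differ from \<^emph>\<open>both\<close> records: all records of a phase
  were taken before it began, so a register leaves them for good, and a call that overwrites a
  register makes the set strictly larger for all later calls.

  The records of successive phases differ in all common registers, so a record of \<open>i\<close> registers
  accounts for \<open>i (i + 1) / 2\<close> distinct writers. Hence \<open>m\<close> registers suffice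
  if \<open>n \<le> m (m - 1) / 2\<close>, and \<open>m = 2 \<lceil>\<surd>n\<rceil>\<close> satisfies this.
\<close>

section \<open>The algorithm: registers, timestamps and the automaton of a process\<close>

type_synonym cell = "(nat \<times> nat list) option"
text \<open>The first component is a phase \<open>k\<close>. \<open>None\<close> marks a call during
  which phase \<open>k\<close> was opened, by itself or by another call; \<open>Some V\<close> marks
  a call that overwrote a register within phase \<open>k\<close> on the strength of its view
  \<open>V\<close>.\<close>

type_synonym stamp = "nat \<times> cell list option"

datatype mode = Collect "cell list" | Commit "cell list" | Answer stamp | Verdict bool

instance mode :: countable
  by countable_datatype

definition writer :: "cell \<Rightarrow> nat" where
  "writer c = fst (the c)"

text \<open>The registers are read from the last to the first, so the head of a view is its latest entry.
  The phase is the number of registers before the first empty one.\<close>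

definition phase :: "cell list \<Rightarrow> nat" where
  "phase V = length (takeWhile (\<lambda>c. c \<noteq> None) V)"

text \<open>Meaningless in phase \<open>0\<close>, where \<open>untouched\<close> and \<open>moved\<close> are empty anyway.\<close>

definition leader :: "cell list \<Rightarrow> nat list" where
  "leader V = snd (the (V ! (phase V - 1)))"

text \<open>The strict bound spares register \<open>phase V - 1\<close>, which holds the record
  itself: as long as the phase lasts, only another opener of the same phase can replace that
  entry.\<close>

definition untouched :: "cell list \<Rightarrow> nat set" where
  "untouched V = {j. Suc j < phase V \<and> writer (V ! j) = leader V ! j}"

definition target :: "cell list \<Rightarrow> nat" where
  "target V = (if untouched V = {} then phase V else SOME j. j \<in> untouched V)"

definition entry :: "nat \<Rightarrow> cell list \<Rightarrow> cell" where
  "entry p V = Some (p, map writer (take (phase V) V))"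

definition stamp_of :: "cell list \<Rightarrow> stamp" where
  "stamp_of V = (if untouched V = {} then (Suc (phase V), None) else (phase V, Some V))"

definition moved :: "nat list \<Rightarrow> nat list \<Rightarrow> cell list \<Rightarrow> nat set" where
  "moved L L' V = {j. Suc j < phase V \<and> writer (V ! j) \<notin> {L ! j, L' ! j}}"

text \<open>Two calls that both yield \<open>(k, None)\<close> contain the first write to register
  \<open>k - 1\<close>, hence overlap and need no order. For the same reason
  \<open>(k, None)\<close> can only come before a stamp of phase \<open>k\<close> with a view, never
  after it.\<close>

fun precedes :: "stamp \<Rightarrow> stamp \<Rightarrow> bool" where
  "precedes (k, x) (k', None) \<longleftrightarrow> k < k'"
| "precedes (k, None) (k', Some V') \<longleftrightarrow> k \<le> k'"
| "precedes (k, Some V) (k', Some V') \<longleftrightarrow> k < k' \<or>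
    k = k' \<and> moved (leader V) (leader V') V \<subset> moved (leader V) (leader V') V'"

text \<open>
  The second look at register \<open>phase V\<close> ensures that the phase had not ended when the view was complete.
  If it had, the process need not write: the next phase was opened during its call. The branches that
  return \<open>Stamp 0\<close> are never taken when \<open>n \<le> m (m - 1) / 2\<close>.
\<close>

fun act :: "nat \<Rightarrow> nat \<Rightarrow> mode \<Rightarrow> (nat, nat, nat) action" where
  "act m p (Collect V) =
    (if length V < m
     then Read (m - Suc (length V)) (\<lambda>v. to_nat (Collect (from_nat v # V)))
     else if phase V < m
     then Read (phase V) (\<lambda>v. to_nat
       (if from_nat v = (None :: cell) then Commit V else Answer (Suc (phase V), None)))
     else Return (Stamp 0) 0)"
| "act m p (Commit V) =
    (if target V < m
     then Write (target V) (to_nat (entry p V)) (to_nat (Answer (stamp_of V)))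
     else Return (Stamp 0) 0)"
| "act m p (Answer x) = Return (Stamp (to_nat x)) 0"
| "act m p (Verdict b) = Return (Truth b) 0"

fun initial_mode :: "nat call \<Rightarrow> mode" where
  "initial_mode GetTS = Collect []"
| "initial_mode (Compare t t') = Verdict (precedes (from_nat t) (from_nat t'))"

definition object :: "nat \<Rightarrow> nat_implementation" where
  "object m = \<lparr>universe = UNIV, init_regs = (\<lambda>r. to_nat (None :: cell)), init_local = (\<lambda>p. 0),
    start = (\<lambda>p c s. to_nat (initial_mode c)), action = (\<lambda>p s. act m p (from_nat s))\<rparr>"

lemma object_simps [simp]:
  "universe (object m) = UNIV"
  "init_regs (object m) r = to_nat (None :: cell)"
  "start (object m) p c s = to_nat (initial_mode c)"
  "action (object m) p s = act m p (from_nat s)"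
  by (simp_all add: object_def)

text \<open>The claim covers unreachable local states too, which is why \<open>act\<close> guards
  every access by a comparison with \<open>m\<close>.\<close>

lemma object_uses_registers: "uses_registers (object m) n m"
proof -
  have "case act m p M of Read r k \<Rightarrow> r < m | Write r v s' \<Rightarrow> r < m | Return x s' \<Rightarrow> True" for p M
    by (cases M) auto
  then show ?thesis
    by (simp add: uses_registers_def)
qed

lemma phase_le: "phase V \<le> length V"
  by (simp add: phase_def length_takeWhile_le)

lemma nth_phase: "phase V < length V \<Longrightarrow> V ! phase V = None"
  using nth_length_takeWhile[of "\<lambda>c. c \<noteq> None" V] unfolding phase_def by blast

lemma nth_less_phase:
  assumes "i < phase V"
  shows "V ! i \<noteq> None"
proof -
  have "takeWhile (\<lambda>c. c \<noteq> None) V ! i \<in> set (takeWhile (\<lambda>c. c \<noteq> None) V)"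
    using assms by (intro nth_mem) (simp add: phase_def)
  then show ?thesis
    using assms set_takeWhileD takeWhile_nth[of i "\<lambda>c. c \<noteq> None" V] by (fastforce simp: phase_def)
qed

lemma le_phaseI:
  assumes "k \<le> length V" "\<And>i. i < k \<Longrightarrow> V ! i \<noteq> None"
  shows "k \<le> phase V"
proof (rule ccontr)
  assume "\<not> k \<le> phase V"
  with assms(1) have "V ! phase V = None"
    by (intro nth_phase) simp
  with assms(2)[of "phase V"] \<open>\<not> k \<le> phase V\<close> show False
    by linarith
qed

lemma target_untouched: "untouched V \<noteq> {} \<Longrightarrow> target V \<in> untouched V"
  by (simp add: target_def some_in_eq)

subsection \<open>Wait-freedom\<close>

text \<open>Bounds the accesses still ahead of a call: the missing reads, the second look and the
  write.\<close>

fun fuel :: "nat \<Rightarrow> mode \<Rightarrow> nat" where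
  "fuel m (Collect V) = m - length V + 2"
| "fuel m (Commit V) = 1"
| "fuel m (Answer x) = 0"
| "fuel m (Verdict b) = 0"

text \<open>While the call is pending, every event of \<open>p\<close> is an access, and each access
  lowers \<open>fuel\<close> by at least one from its initial value of at most
  \<open>m + 2\<close>.\<close>

lemma fuel_bound:
  assumes "run (object m) n es C" "i < length es" "es ! i = Invoke p c"
    and "\<And>j x. i < j \<Longrightarrow> j < length es \<Longrightarrow> es ! j \<noteq> Respond p x"
  shows "busy C p \<and>
    card {j. i < j \<and> j < length es \<and> proc (es ! j) = p} + fuel m (from_nat (local C p)) \<le> m + 2"
  using assms
proof (induction rule: run.induct)
  case init
  then show ?case by simp
next
  case (step es C e C')
  let ?J = "\<lambda>es. {j. i < j \<and> j < length es \<and> proc (es ! j) = p}"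
  show ?case
  proof (cases "i = length es")
    case True
    then have e: "e = Invoke p c"
      using step.prems by simp
    have J: "?J (es @ [e]) = {}"
      using True by auto
    have "fuel m (initial_mode c) \<le> m + 2"
      by (cases c) auto
    moreover have "busy C' p \<and> local C' p = to_nat (initial_mode c)"
      using step.hyps(2) unfolding e by (auto elim: step.cases)
    ultimately show ?thesis
      unfolding J by simp
  next
    case False
    then have i: "i < length es"
      using step.prems by simp
    have "es ! i = Invoke p c"
      using step.prems i by (simp add: nth_append)
    moreover have "es ! j \<noteq> Respond p x" if "i < j" "j < length es" for j x
      using step.prems(3)[of j] that by (simp add: nth_append)
    ultimately have IH: "busy C p" "card (?J es) + fuel m (from_nat (local C p)) \<le> m + 2"
      using step.IH i by auto
    have J: "?J (es @ [e]) = (if proc e = p then insert (length es) (?J es) else ?J es)"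
      using i by (auto simp: nth_append less_Suc_eq)
    have "finite (?J es)"
      by simp
    then have J': "card (?J (es @ [e])) = (if proc e = p then Suc (card (?J es)) else card (?J es))"
      unfolding J by simp
    have noresp: "e \<noteq> Respond p x" for x
      using step.prems(3)[of "length es"] i by simp
    show ?thesis
      using step.hyps(2)
    proof cases
      case (invoke_step q c)
      with IH have "q \<noteq> p" by auto
      with IH J' invoke_step show ?thesis by auto
    next
      case (read_step q r k)
      with IH J' show ?thesis
        by (cases "from_nat (local C q) :: mode") (auto split: if_splits)
    next
      case (write_step q r v s)
      with IH J' show ?thesis
        by (cases "from_nat (local C q) :: mode") (auto split: if_splits)
    next
      case (respond_step q x s)
      with noresp have "q \<noteq> p" by auto
      with IH J' respond_step show ?thesis by auto
    qed
  qed
qed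

lemma object_wait_free: "wait_free (object m) n"
  unfolding wait_free_def
proof (intro allI impI, elim conjE)
  fix \<sigma> p c i
  assume \<sigma>: "infinite_one_shot_execution (object m) n \<sigma>" "\<sigma> i = Invoke p c"
    and inf: "infinite {j. proc (\<sigma> j) = p}"
  show "\<exists>k > i. \<exists>x. \<sigma> k = Respond p x"
  proof (rule ccontr)
    assume pending: "\<not> (\<exists>k > i. \<exists>x. \<sigma> k = Respond p x)"
    have "infinite ({j. proc (\<sigma> j) = p} - {..i})"
      using inf by (simp add: Diff_infinite_finite)
    \<comment> \<open>One more than the \<open>m + 2\<close> events that \<open>fuel_bound\<close>
      allows.\<close>
    then obtain J where J: "J \<subseteq> {j. proc (\<sigma> j) = p} - {..i}" "finite J" "card J = m + 3"
      using infinite_arbitrarily_large by blast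
    define K where "K = Suc (Max (insert i J))"
    have K: "j < K" if "j \<in> insert i J" for j
      using that J(2) unfolding K_def by (meson Max_ge finite_insert le_imp_less_Suc)
    obtain C where "run (object m) n (map \<sigma> [0..<K]) C"
      using \<sigma>(1) by (auto simp: infinite_one_shot_execution_def one_shot_execution_def)
    from fuel_bound[OF this, of i p c]
    have "card {j. i < j \<and> j < K \<and> proc (map \<sigma> [0..<K] ! j) = p} \<le> m + 2"
      using \<sigma>(2) pending K by auto
    moreover have "J \<subseteq> {j. i < j \<and> j < K \<and> proc (map \<sigma> [0..<K] ! j) = p}"
      using J K by auto
    then have "card J \<le> card {j. i < j \<and> j < K \<and> proc (map \<sigma> [0..<K] ! j) = p}"
      by (intro card_mono) auto
    ultimately show False
      using J by simp
  qed
qed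

subsection \<open>Executions\<close>

text \<open>Configurations are indexed by all natural numbers and stay constant after the last
  event, so that times need no upper bound in the arguments below.\<close>

locale execution =
  fixes n m :: nat and es :: "nat event list" and cfg :: "nat \<Rightarrow> (nat, nat) config"
  assumes cfg_0: "cfg 0 = init_config (object m)"
    and cfg_Suc: "t < length es \<Longrightarrow> step (object m) n (cfg t) (es ! t) (cfg (Suc t))"
    and cfg_stutter: "length es \<le> t \<Longrightarrow> cfg (Suc t) = cfg t"
    and one_shot: "one_shot es"
begin

definition mem :: "nat \<Rightarrow> nat \<Rightarrow> cell" where
  "mem t i = from_nat (regs (cfg t) i)"

definition mode :: "nat \<Rightarrow> nat \<Rightarrow> mode" where
  "mode t p = from_nat (local (cfg t) p)"

definition active :: "nat \<Rightarrow> nat \<Rightarrow> bool" where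
  "active t = busy (cfg t)"

definition owner :: "nat \<Rightarrow> nat \<Rightarrow> nat option" where
  "owner t i = map_option fst (mem t i)"

definition invoked :: "nat \<Rightarrow> nat \<Rightarrow> nat \<Rightarrow> bool" where
  "invoked s t p \<longleftrightarrow> s < t \<and> s < length es \<and> es ! s = Invoke p GetTS"

lemma mem_0: "mem 0 i = None"
  by (simp add: mem_def cfg_0 init_config_def)

lemma active_0: "\<not> active 0 p"
  by (simp add: active_def cfg_0 init_config_def)

text \<open>Decodes the numbers in registers and local states once and for all; the inductions over
  time below split along these six cases.\<close>

lemma transition_cases [case_names stutter invoke collect recheck commit respond]:
  obtains
    "length es \<le> t" "mem (Suc t) = mem t" "mode (Suc t) = mode t" "active (Suc t) = active t"
  | p c where "t < length es" "es ! t = Invoke p c" "\<not> active t p"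
      "mem (Suc t) = mem t" "mode (Suc t) = (mode t)(p := initial_mode c)"
      "active (Suc t) = (active t)(p := True)"
  | p V where "t < length es" "es ! t = Access p" "active t p" "mode t p = Collect V"
      "length V < m" "mem (Suc t) = mem t"
      "mode (Suc t) = (mode t)(p := Collect (mem t (m - Suc (length V)) # V))"
      "active (Suc t) = active t"
  | p V where "t < length es" "es ! t = Access p" "active t p" "mode t p = Collect V"
      "m \<le> length V" "phase V < m" "mem (Suc t) = mem t"
      "mode (Suc t) = (mode t)(p := if mem t (phase V) = None then Commit V
        else Answer (Suc (phase V), None))"
      "active (Suc t) = active t"
  | p V where "t < length es" "es ! t = Access p" "p < n" "active t p" "mode t p = Commit V"
      "target V < m" "mem (Suc t) = (mem t)(target V := entry p V)"
      "mode (Suc t) = (mode t)(p := Answer (stamp_of V))" "active (Suc t) = active t"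
  | p x where "t < length es" "es ! t = Respond p x" "active t p" "mem (Suc t) = mem t"
      "\<And>q. q \<noteq> p \<Longrightarrow> mode (Suc t) q = mode t q" "active (Suc t) = (active t)(p := False)"
      "case mode t p of Collect V \<Rightarrow> m \<le> length V \<and> m \<le> phase V
       | Commit V \<Rightarrow> m \<le> target V | Answer y \<Rightarrow> x = Stamp (to_nat y) | Verdict b \<Rightarrow> x = Truth b"
proof (cases "t < length es")
  case False
  then have "cfg (Suc t) = cfg t"
    using cfg_stutter by simp
  with False show ?thesis
    by (intro that(1)) (auto simp: mem_def mode_def active_def fun_eq_iff)
next
  case True
  show ?thesis
    using cfg_Suc[OF True]
  proof cases
    case (invoke_step p c)
    with True show ?thesis
      by (intro that(2)[of p c]) (auto simp: mem_def mode_def active_def fun_eq_iff)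
  next
    case (read_step p r k)
    show ?thesis
    proof (cases "mode t p")
      case (Collect V)
      show ?thesis
      proof (cases "length V < m")
        case True': True
        have "r = m - Suc (length V)" "k = (\<lambda>v. to_nat (Collect (from_nat v # V)))"
          using read_step Collect True' by (auto simp: mode_def)
        with True True' read_step Collect show ?thesis
          by (intro that(3)[of p V]) (auto simp: mem_def mode_def active_def fun_eq_iff)
      next
        case False
        with read_step Collect have r: "phase V < m" "r = phase V"
          and k: "k = (\<lambda>v. to_nat (if from_nat v = (None :: cell) then Commit V
            else Answer (Suc (phase V), None)))"
          by (auto simp: mode_def split: if_splits)
        have "mode (Suc t) p = (if mem t (phase V) = None then Commit V
            else Answer (Suc (phase V), None))"
          unfolding mode_def mem_def read_step(2) k r(2) by simp
        with True False read_step Collect r show ?thesis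
          by (intro that(4)[of p V]) (auto simp: mem_def mode_def active_def fun_eq_iff split: if_splits)
      qed
    qed (use read_step in \<open>auto simp: mode_def split: if_splits\<close>)
  next
    case (write_step p r v s)
    show ?thesis
    proof (cases "mode t p")
      case (Commit V)
      with True write_step show ?thesis
        by (intro that(5)[of p V]) (auto simp: mem_def mode_def active_def fun_eq_iff split: if_splits)
    qed (use write_step in \<open>auto simp: mode_def split: if_splits\<close>)
  next
    case (respond_step p x s)
    with True show ?thesis
      by (intro that(6)[of p x])
        (auto simp: mem_def mode_def active_def fun_eq_iff split: mode.split if_splits)
  qed
qed

lemma mem_persistent: "t \<le> t' \<Longrightarrow> mem t i \<noteq> None \<Longrightarrow> mem t' i \<noteq> None"
proof (induction t' rule: dec_induct)
  case (step t')
  then show ?case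
    by (cases t' rule: transition_cases) (auto simp: entry_def)
qed

lemma mem_None_before: "t \<le> t' \<Longrightarrow> mem t' i = None \<Longrightarrow> mem t i = None"
  using mem_persistent by blast

lemma mem_None_less: "mem u i = None \<Longrightarrow> mem v i \<noteq> None \<Longrightarrow> u < v"
  using mem_persistent by (meson not_le)

lemma mem_out: "m \<le> i \<Longrightarrow> mem t i = None"
proof (induction t)
  case (Suc t)
  then show ?case
    by (cases t rule: transition_cases) auto
qed (simp add: mem_0)

lemma owner_less: "owner t i = Some p \<Longrightarrow> p < n"
proof (induction t)
  case (Suc t)
  then show ?case
    by (cases t rule: transition_cases) (auto simp: owner_def entry_def split: if_splits)
qed (simp add: owner_def mem_0)

lemma invoked_unique: "invoked s t p \<Longrightarrow> invoked s' t' p \<Longrightarrow> s = s'"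
  using one_shot by (auto simp: invoked_def one_shot_def)

lemma invoked_mono: "invoked s t p \<Longrightarrow> t \<le> t' \<Longrightarrow> invoked s t' p"
  by (auto simp: invoked_def)

subsection \<open>Collected views\<close>

text \<open>\<open>s\<close> is the invocation time and \<open>\<tau> j\<close> the time after
  \<open>s\<close> at which entry \<open>j\<close> was read. A partial view covers the last
  \<open>length V\<close> registers, hence the shifted index; lower registers are read
  later.\<close>

definition collected :: "nat \<Rightarrow> cell list \<Rightarrow> nat \<Rightarrow> bool" where
  "collected s V t \<longleftrightarrow> s < t \<and> length V \<le> m \<and>
    (\<exists>\<tau>. \<forall>j<length V. s < \<tau> j \<and> \<tau> j \<le> t \<and> V ! j = mem (\<tau> j) (m - length V + j) \<and>
      (\<forall>i\<le>j. \<tau> j \<le> \<tau> i))"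

text \<open>\<open>u\<close> is the time of the second look: the phase of the view had not ended
  when all reads were done.\<close>

definition verified :: "nat \<Rightarrow> cell list \<Rightarrow> nat \<Rightarrow> bool" where
  "verified s V u \<longleftrightarrow> collected s V u \<and> length V = m \<and> phase V < m \<and> mem u (phase V) = None"

lemma collected_mono: "collected s V t \<Longrightarrow> t \<le> t' \<Longrightarrow> collected s V t'"
  unfolding collected_def by (meson order_trans order_less_le_trans)

lemma collected_Cons:
  assumes "collected s V t" "length V < m"
  shows "collected s (mem t (m - Suc (length V)) # V) t"
proof -
  obtain \<tau> where \<tau>: "\<forall>j<length V. s < \<tau> j \<and> \<tau> j \<le> t \<and> V ! j = mem (\<tau> j) (m - length V + j) \<and>
      (\<forall>i\<le>j. \<tau> j \<le> \<tau> i)"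
    using assms(1) unfolding collected_def by blast
  have "m - length V + j = m - Suc (length V) + Suc j" for j
    using assms(2) by simp
  \<comment> \<open>The new head was read at time \<open>t\<close>; the older read times shift by
    one position.\<close>
  with \<tau> assms show ?thesis
    unfolding collected_def
    by (auto intro!: exI[of _ "case_nat t \<tau>"] simp: less_Suc_eq_le nth_Cons' all_conj_distrib
        split: nat.splits)
qed

lemma verifiedE:
  assumes "verified s V u"
  obtains \<tau> where "\<And>j. j < m \<Longrightarrow> s < \<tau> j" "\<And>j. j < m \<Longrightarrow> \<tau> j \<le> u"
    "\<And>j. j < m \<Longrightarrow> V ! j = mem (\<tau> j) j" "\<And>i j. i \<le> j \<Longrightarrow> j < m \<Longrightarrow> \<tau> j \<le> \<tau> i"
proof -
  have "length V = m"
    using assms by (simp add: verified_def)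
  with assms obtain \<tau> where \<tau>: "\<forall>j<m. s < \<tau> j \<and> \<tau> j \<le> u \<and> V ! j = mem (\<tau> j) j \<and>
      (\<forall>i\<le>j. \<tau> j \<le> \<tau> i)"
    unfolding verified_def collected_def by (metis add_0 diff_self_eq_0)
  then show ?thesis
    by (intro that[of \<tau>]) auto
qed

lemma stages:
  assumes "active t p"
  shows "case mode t p of
      Collect V \<Rightarrow> \<exists>s. invoked s t p \<and> collected s V t
    | Commit V \<Rightarrow> \<exists>s u. invoked s t p \<and> u < t \<and> verified s V u
    | Answer x \<Rightarrow> \<exists>s. invoked s t p
    | Verdict b \<Rightarrow> True"
  using assms
proof (induction t arbitrary: p)
  case 0
  then show ?case by (simp add: active_0)
next
  case (Suc t)
  note mono = invoked_mono[OF _ le_SucI[OF order_refl]] collected_mono[OF _ le_SucI[OF order_refl]]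
  have same: ?case if "active t p" "mode (Suc t) p = mode t p"
    using Suc.IH[OF that(1)] that(2) by (auto split: mode.splits intro: mono less_SucI)
  show ?case
  proof (cases t rule: transition_cases)
    case stutter
    with Suc.prems show ?thesis by (intro same) auto
  next
    case (invoke q c)
    show ?thesis
    proof (cases "p = q")
      case True
      with invoke show ?thesis
        by (cases c) (auto simp: invoked_def collected_def)
    qed (use invoke Suc.prems in \<open>intro same; auto\<close>)
  next
    case (collect q V)
    show ?thesis
    proof (cases "p = q")
      case True
      with collect Suc.IH[of q] show ?thesis
        by (auto intro: mono collected_Cons)
    qed (use collect Suc.prems in \<open>intro same; auto\<close>)
  next
    case (recheck q V)
    show ?thesis
    proof (cases "p = q")
      case True
      obtain s where s: "invoked s t q" "collected s V t"
        using recheck Suc.IH[of q] by auto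
      then have "length V = m"
        using recheck by (simp add: collected_def)
      with True recheck s show ?thesis
        by (auto intro: mono simp: verified_def)
    qed (use recheck Suc.prems in \<open>intro same; auto\<close>)
  next
    case (commit q V)
    show ?thesis
    proof (cases "p = q")
      case True
      with commit Suc.IH[of q] show ?thesis
        by (auto intro: mono)
    qed (use commit Suc.prems in \<open>intro same; auto\<close>)
  next
    case (respond q x)
    with Suc.prems show ?thesis by (intro same) (auto split: if_splits)
  qed
qed

lemma commit_verified:
  assumes "active t p" "mode t p = Commit V"
  obtains s u where "invoked s t p" "u < t" "verified s V u"
  using stages[OF assms(1)] assms(2) by auto

subsection \<open>Each process writes at most once\<close>

text \<open>The only write of a call is the step that leaves \<open>Commit\<close>, and an earlier
  call that could have written is excluded because the execution is one-shot.\<close>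

lemma unwritten:
  "(\<nexists>s. invoked s t p) \<or> active t p \<and> (\<exists>V. mode t p = Collect V \<or> mode t p = Commit V) \<Longrightarrow>
    u \<le> t \<Longrightarrow> owner u i \<noteq> Some p"
proof (induction t arbitrary: p u i)
  case 0
  then show ?case by (simp add: owner_def mem_0)
next
  case (Suc t)
  note mono = invoked_mono[OF _ le_SucI[OF order_refl]]
  \<comment> \<open>Times up to \<open>t\<close> are covered by the induction hypothesis, so only
    the registers at \<open>Suc t\<close> need attention.\<close>
  have keep: ?case
    if "(\<nexists>s. invoked s t p) \<or> active t p \<and> (\<exists>V. mode t p = Collect V \<or> mode t p = Commit V)"
      and "owner (Suc t) i = Some p \<Longrightarrow> owner t i = Some p"
    using Suc.IH[OF that(1), of u i] Suc.IH[OF that(1), of t i] that(2) Suc.prems(2)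
    by (auto simp: le_Suc_eq)
  show ?case
  proof (cases t rule: transition_cases)
    case stutter
    with Suc.prems(1) mono[of _ t p] show ?thesis by (intro keep) (simp_all add: owner_def, metis)
  next
    case (invoke q c)
    have "(\<nexists>s. invoked s t p) \<or> active t p \<and> (\<exists>V. mode t p = Collect V \<or> mode t p = Commit V)"
    proof (cases "p = q")
      case True
      show ?thesis
      proof (cases c)
        case GetTS
        \<comment> \<open>The call invoked now is the only \<open>getTS\<close> call of
          \<open>p\<close>, so the first alternative holds at \<open>t\<close>.\<close>
        have "invoked t (Suc t) p"
          using invoke True GetTS by (simp add: invoked_def)
        then have "\<not> invoked s t p" for s
          using invoked_unique[of t "Suc t" p s t] by (auto simp: invoked_def)
        then show ?thesis by simp
      next
        case (Compare t1 t2)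
        with True invoke Suc.prems(1) have "\<nexists>s. invoked s (Suc t) p" by auto
        with mono show ?thesis by blast
      qed
    qed (use invoke Suc.prems(1) in \<open>auto dest: mono\<close>)
    with invoke show ?thesis
      by (intro keep) (simp_all add: owner_def)
  next
    case (collect q V)
    have "(\<nexists>s. invoked s t p) \<or> active t p \<and> (\<exists>V. mode t p = Collect V \<or> mode t p = Commit V)"
      using collect Suc.prems(1) by (auto dest: mono split: if_splits)
    with collect show ?thesis
      by (intro keep) (simp_all add: owner_def)
  next
    case (recheck q V)
    have "(\<nexists>s. invoked s t p) \<or> active t p \<and> (\<exists>V. mode t p = Collect V \<or> mode t p = Commit V)"
      using recheck Suc.prems(1) by (auto dest: mono split: if_splits)
    with recheck show ?thesis
      by (intro keep) (simp_all add: owner_def)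
  next
    case (commit q V)
    obtain s where "invoked s t q"
      using commit_verified commit by metis
    then have "p \<noteq> q"
      using Suc.prems(1) commit by (auto dest: mono)
    then have "(\<nexists>s. invoked s t p) \<or> active t p \<and> (\<exists>V. mode t p = Collect V \<or> mode t p = Commit V)"
      using commit Suc.prems(1) by (auto dest: mono split: if_splits)
    with commit \<open>p \<noteq> q\<close> show ?thesis
      by (intro keep) (simp_all add: owner_def entry_def split: if_splits)
  next
    case (respond q x)
    have "(\<nexists>s. invoked s t p) \<or> active t p \<and> (\<exists>V. mode t p = Collect V \<or> mode t p = Commit V)"
      using respond Suc.prems(1) by (auto dest: mono split: if_splits)
    with respond show ?thesis
      by (intro keep) (simp_all add: owner_def)
  qed
qed

text \<open>With a single write per process, ownership starts once, in one register, and is never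
  regained after being overwritten.\<close>

lemma owner_once:
  "u \<le> v \<Longrightarrow> owner u i = Some a \<Longrightarrow> owner v j = Some a \<Longrightarrow>
    i = j \<and> (\<forall>w. u \<le> w \<and> w \<le> v \<longrightarrow> owner w i = Some a)"
proof (induction v arbitrary: u i j)
  case 0
  then show ?case by (simp add: owner_def mem_0)
next
  case (Suc v)
  have keep: ?case if "owner v j = Some a" "u = Suc v \<Longrightarrow> owner v i = Some a"
  proof (cases "u = Suc v")
    case True
    with Suc.IH[of v i j] that Suc.prems show ?thesis by (auto simp: le_Suc_eq)
  next
    case False
    with Suc.IH[of u i j] that Suc.prems show ?thesis by (auto simp: le_Suc_eq)
  qed
  have same: ?case if "mem (Suc v) = mem v"
    using Suc.prems that by (intro keep) (simp_all add: owner_def)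
  show ?case
  proof (cases v rule: transition_cases)
    case (commit p V)
    \<comment> \<open>The writer was in \<open>Commit\<close> until now and has therefore owned
      nothing before.\<close>
    have unw: "owner u' i' \<noteq> Some p" if "u' \<le> v" for u' i'
      using unwritten[of v p u' i'] commit that by auto
    have new: "owner (Suc v) i' = (if i' = target V then Some p else owner v i')" for i'
      using commit by (simp add: owner_def entry_def)
    show ?thesis
    proof (cases "a = p")
      case True
      with unw Suc.prems have "u = Suc v" by (auto simp: le_Suc_eq)
      with Suc.prems True new unw show ?thesis by (auto split: if_splits simp: le_Suc_eq)
    next
      case False
      with Suc.prems new show ?thesis by (intro keep) (auto split: if_splits)
    qed
  qed (rule same, assumption)+
qed

lemma owner_unique: "owner u i = Some a \<Longrightarrow> owner v j = Some a \<Longrightarrow> i = j"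
  using owner_once[of u v i a j] owner_once[of v u j a i] by (cases "u \<le> v") auto

text \<open>Excludes the ABA problem, so that agreement of a later view with an old record is
  conclusive.\<close>

lemma owner_between:
  "owner u i = Some a \<Longrightarrow> owner v i = Some a \<Longrightarrow> u \<le> w \<Longrightarrow> w \<le> v \<Longrightarrow> owner w i = Some a"
  using owner_once[of u v i a i] by simp

lemma owner_writer: "mem u i \<noteq> None \<Longrightarrow> owner u i = Some (writer (mem u i))"
  by (auto simp: owner_def writer_def)

subsection \<open>Snapshots and the number of registers\<close>

text \<open>The set \<open>A\<close> collects the distinct writers that earlier phases have used up.\<close>

definition snapshot :: "nat \<Rightarrow> nat list \<Rightarrow> bool" where
  "snapshot i S \<longleftrightarrow> length S = i \<and> (\<exists>\<rho> A.
    (\<forall>j<i. mem (\<rho> j) i = None \<and> owner (\<rho> j) j = Some (S ! j)) \<and>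
    finite A \<and> 2 * card A = i * (i + 1) \<and> (\<forall>a\<in>A. \<exists>j<i. \<exists>u\<le>\<rho> j. owner u j = Some a))"

text \<open>A call that finds no untouched register sees \<open>k = phase V\<close> writers, none of
  which the record of the current phase accounts for; they raise the count from
  \<open>(k - 1) * k / 2\<close> to \<open>k * (k + 1) / 2\<close>. The premise on times up to
  \<open>u\<close> is the induction hypothesis of \<open>leader_snapshot\<close>.\<close>

lemma verified_snapshot:
  assumes V: "verified s V u" and full: "untouched V = {}"
    and IH: "\<And>t i q S. t \<le> u \<Longrightarrow> mem t i = Some (q, S) \<Longrightarrow> mem t (Suc i) = None \<Longrightarrow> snapshot i S"
  shows "snapshot (phase V) (map writer (take (phase V) V))"
proof -
  obtain \<tau> where \<tau>: "\<And>j. j < m \<Longrightarrow> s < \<tau> j" "\<And>j. j < m \<Longrightarrow> \<tau> j \<le> u"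
    "\<And>j. j < m \<Longrightarrow> V ! j = mem (\<tau> j) j" "\<And>i j. i \<le> j \<Longrightarrow> j < m \<Longrightarrow> \<tau> j \<le> \<tau> i"
    using verifiedE[OF V] by metis
  define k where "k = phase V"
  define S where "S = map writer (take k V)"
  have k: "k < m" "mem u k = None" and len: "length V = m"
    using V by (auto simp: verified_def k_def)
  have S: "S ! j = writer (V ! j)" if "j < k" for j
    using k len that by (auto simp: S_def)
  have lenS: "length S = k"
    using k len by (auto simp: S_def)
  have own: "owner (\<tau> j) j = Some (S ! j)" if "j < k" for j
    using that owner_writer[of "\<tau> j" j] nth_less_phase[of j V] \<tau>(3)[of j] k S[OF that]
    by (simp add: k_def)
  have none: "mem (\<tau> j) k = None" if "j < k" for j
    using mem_None_before[of "\<tau> j" u k] \<tau>(2)[of j] k that by auto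
  have "\<exists>A. finite A \<and> 2 * card A = k * (k + 1) \<and> (\<forall>a\<in>A. \<exists>j<k. \<exists>u\<le>\<tau> j. owner u j = Some a)"
  proof (cases k)
    case 0
    then show ?thesis by (intro exI[of _ "{}"]) auto
  next
    case (Suc i)
    obtain q S0 where q: "V ! i = Some (q, S0)"
      using nth_less_phase[of i V] Suc by (auto simp: k_def)
    have mi: "mem (\<tau> i) i = Some (q, S0)"
      using q \<tau>(3)[of i] Suc k by simp
    have "snapshot i S0"
      using IH[of "\<tau> i" i q S0] mi \<tau>(2)[of i] none[of i] Suc k by simp
    then obtain \<rho> A where len0: "length S0 = i"
      and \<rho>: "\<And>j. j < i \<Longrightarrow> mem (\<rho> j) i = None" "\<And>j. j < i \<Longrightarrow> owner (\<rho> j) j = Some (S0 ! j)"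
      and A: "finite A" "2 * card A = i * (i + 1)"
        "\<And>a. a \<in> A \<Longrightarrow> \<exists>j<i. \<exists>u\<le>\<rho> j. owner u j = Some a"
      unfolding snapshot_def by blast
    have lead: "leader V = S0"
      using q Suc by (simp add: leader_def k_def[symmetric])
    have diff: "S ! j \<noteq> S0 ! j" if "j < i" for j
      using full that Suc S[of j] by (auto simp: untouched_def lead k_def[symmetric])
    \<comment> \<open>Register \<open>i\<close> was still empty at \<open>\<rho> j\<close> but
      filled at \<open>\<tau> i\<close>, and register \<open>j\<close> was read no earlier than
      register \<open>i\<close>.\<close>
    have order: "\<rho> j \<le> \<tau> j" if "j < i" for j
      using mem_None_less[OF \<rho>(1)[OF that], of "\<tau> i"] mi \<tau>(4)[of j i] that Suc k by simp
    \<comment> \<open>A writer counted before that is still present at \<open>\<tau> j\<close> would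
      also have been present at \<open>\<rho> j\<close>, so register \<open>j\<close> would agree
      with the record. Register \<open>i\<close> itself is safe because writers in \<open>A\<close>
      owned lower registers.\<close>
    have disj: "S ! j \<notin> A" if "j < k" for j
    proof
      assume "S ! j \<in> A"
      then obtain j' w where w: "j' < i" "w \<le> \<rho> j'" "owner w j' = Some (S ! j)"
        using A(3) by blast
      then have "j' = j"
        using owner_unique own[OF that] by blast
      with w have "owner (\<rho> j) j = Some (S ! j)"
        using owner_between[OF _ own[OF that], of w "\<rho> j"] order by auto
      with \<rho>(2)[of j] diff[of j] w \<open>j' = j\<close> show False by simp
    qed
    have "inj_on (\<lambda>j. S ! j) {..<k}"
      using own owner_unique by (intro inj_onI) (metis lessThan_iff)
    then have card: "card ((\<lambda>j. S ! j) ` {..<k}) = k"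
      by (simp add: card_image)
    let ?A = "A \<union> (\<lambda>j. S ! j) ` {..<k}"
    have "card ?A = card A + k"
      using card A(1) disj by (subst card_Un_disjoint) auto
    then have "2 * card ?A = k * (k + 1)"
      using A(2) Suc by simp
    moreover have "\<exists>j<k. \<exists>u\<le>\<tau> j. owner u j = Some a" if "a \<in> ?A" for a
      using that
    proof
      assume "a \<in> A"
      then obtain j w where "j < i" "w \<le> \<rho> j" "owner w j = Some a"
        using A(3) by blast
      with order Suc show ?thesis by (meson less_SucI order_trans)
    next
      assume "a \<in> (\<lambda>j. S ! j) ` {..<k}"
      with own show ?thesis by auto
    qed
    ultimately show ?thesis
      using A(1) by (intro exI[of _ ?A]) auto
  qed
  then show ?thesis
    unfolding snapshot_def k_def[symmetric] S_def[symmetric]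
    using lenS none own by blast
qed

text \<open>Overwriting register \<open>i\<close> within a phase requires a view of phase above
  \<open>i + 1\<close>, hence a filled register \<open>i + 1\<close>. As long as that one is empty,
  the entry in register \<open>i\<close> comes from a call that opened phase \<open>i + 1\<close>,
  and \<open>verified_snapshot\<close> applies to its view.\<close>

lemma leader_snapshot:
  "mem t i = Some (q, S) \<Longrightarrow> mem t (Suc i) = None \<Longrightarrow> snapshot i S"
proof (induction t arbitrary: i q S rule: less_induct)
  case (less t)
  show ?case
  proof (cases t)
    case 0
    with less.prems show ?thesis by (simp add: mem_0)
  next
    case (Suc t')
    have None: "mem t' (Suc i) = None"
      using mem_None_before[of t' t "Suc i"] less.prems Suc by auto
    show ?thesis
    proof (cases t' rule: transition_cases)
      case (commit p V)
      show ?thesis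
      proof (cases "i = target V")
        case True
        obtain s u where V: "u < t'" "verified s V u"
          using commit_verified commit by metis
        obtain \<tau> where \<tau>: "\<And>j. j < m \<Longrightarrow> \<tau> j \<le> u" "\<And>j. j < m \<Longrightarrow> V ! j = mem (\<tau> j) j"
          using verifiedE[OF V(2)] by metis
        have "untouched V = {}"
        proof (rule ccontr)
          assume "untouched V \<noteq> {}"
          then have i: "Suc i < phase V"
            using target_untouched True by (auto simp: untouched_def)
          then have "Suc i < m"
            using V by (auto simp: verified_def)
          then have "mem t' (Suc i) \<noteq> None"
            using mem_persistent[of "\<tau> (Suc i)" t' "Suc i"] \<tau>[of "Suc i"] nth_less_phase[OF i] V(1)
            by auto
          with None show False by simp
        qed
        moreover from this have "i = phase V" "S = map writer (take (phase V) V)"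
          using True commit less.prems Suc by (auto simp: target_def entry_def)
        moreover have "snapshot i' S'"
          if "u' \<le> u" "mem u' i' = Some (q', S')" "mem u' (Suc i') = None" for u' i' q' S'
          using less.IH[OF _ that(2,3)] that(1) V(1) Suc by simp
        ultimately show ?thesis
          using verified_snapshot[OF V(2)] by blast
      qed (use commit less.IH[of t'] less.prems Suc None in auto)
    qed (use less.IH[of t'] less.prems Suc None in auto)
  qed
qed

text \<open>If all registers were filled, the record in the last one would account for
  \<open>m * (m - 1) / 2\<close> writers of lower registers, and the owner of the last register
  would be one more process.\<close>

lemma phase_less:
  assumes "n \<le> m * (m - 1) div 2" "0 < m" "collected s V t" "m \<le> length V"
  shows "phase V < m"
proof (rule ccontr)
  assume "\<not> phase V < m"
  moreover have len: "length V = m"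
    using assms(3,4) by (simp add: collected_def)
  ultimately have "m - 1 < phase V"
    using assms(2) by simp
  then obtain q S where q: "V ! (m - 1) = Some (q, S)"
    using nth_less_phase[of "m - 1" V] by auto
  obtain u where u: "mem u (m - 1) = Some (q, S)"
    using assms(2,3) len q unfolding collected_def by (metis add_0 diff_less diff_self_eq_0 zero_less_one)
  \<comment> \<open>Index \<open>m\<close> lies outside the registers and counts as forever
    empty.\<close>
  have "snapshot (m - 1) S"
    using leader_snapshot[OF u] mem_out assms(2) by simp
  then obtain \<rho> :: "nat \<Rightarrow> nat" and A where A: "finite A" "2 * card A = (m - 1) * (m - 1 + 1)"
    "\<And>a. a \<in> A \<Longrightarrow> \<exists>j<m - 1. \<exists>u\<le>\<rho> j. owner u j = Some a"
    unfolding snapshot_def by blast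
  have own: "owner u (m - 1) = Some q"
    using u by (simp add: owner_def)
  have "q \<notin> A"
    using A(3) owner_unique[OF own] by (metis less_irrefl)
  have "insert q A \<subseteq> {..<n}"
    using A(3) own owner_less by auto
  then have "Suc (card A) \<le> n"
    using card_mono[of "{..<n}" "insert q A"] \<open>q \<notin> A\<close> A(1) by simp
  moreover have "card A = m * (m - 1) div 2"
    using A(2) assms(2) by (simp add: mult.commute)
  ultimately show False
    using assms(1) by simp
qed

subsection \<open>Timestamps of completed calls\<close>

text \<open>What a call of \<open>p\<close> invoked at \<open>s\<close> guarantees at time
  \<open>t\<close>. The first clause says that phase \<open>k\<close> began in between, which fits
  openers as well as calls whose second look came too late. In the second, \<open>w\<close> is the
  first time at which \<open>p\<close> owns a register, that is, the time right after its
  write.\<close>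

fun outcome :: "nat \<Rightarrow> nat \<Rightarrow> nat \<Rightarrow> stamp \<Rightarrow> bool" where
  "outcome s t p (k, None) \<longleftrightarrow> 0 < k \<and> mem s (k - 1) = None \<and> (\<forall>i<k. mem t i \<noteq> None)"
| "outcome s t p (k, Some V) \<longleftrightarrow> k = phase V \<and>
    (\<exists>u w j. verified s V u \<and> u < w \<and> w \<le> t \<and> j \<in> untouched V \<and> owner w j = Some p \<and>
      (\<forall>w'<w. \<forall>i. owner w' i \<noteq> Some p))"

lemma outcome_Suc:
  assumes "outcome s t p x"
  shows "outcome s (Suc t) p x"
proof -
  obtain k y where "x = (k, y)"
    by (cases x)
  with assms show ?thesis
    using mem_persistent[of t "Suc t"] by (cases y) (auto, meson le_SucI)
qed

lemma phase_visible:
  assumes "collected s V t" "length V = m" "i < phase V" "t \<le> t'"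
  shows "mem t' i \<noteq> None"
proof -
  have "i < length V"
    using assms(3) phase_le[of V] by simp
  then obtain v where "v \<le> t" "V ! i = mem v i"
    using assms(1,2) unfolding collected_def by (metis add_0 diff_self_eq_0)
  then show ?thesis
    using mem_persistent[of v t' i] nth_less_phase[OF assms(3)] assms(4) by simp
qed

lemma phase_unstarted:
  assumes "collected s V t" "length V = m" "phase V < m"
  shows "mem s (phase V) = None"
proof -
  obtain v where "s < v" "V ! phase V = mem v (phase V)"
    using assms unfolding collected_def by (metis add_0 diff_self_eq_0)
  then show ?thesis
    using mem_None_before[of s v "phase V"] nth_phase[of V] assms(2,3) by auto
qed

text \<open>An answer arises either from a failed second look or from the write; in both cases a
  register that was read as empty was also empty at the invocation.\<close>

lemma answer_outcome:
  assumes "active t p" "mode t p = Answer x"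
  shows "\<exists>s. invoked s t p \<and> outcome s t p x"
  using assms
proof (induction t arbitrary: p x)
  case 0
  then show ?case by (simp add: active_0)
next
  case (Suc t)
  have same: ?case if "active t p" "mode (Suc t) p = mode t p"
    using Suc.IH[OF that(1), of x] that(2) Suc.prems(2) outcome_Suc invoked_mono[of _ t p "Suc t"]
    by (metis le_SucI order_refl)
  show ?case
  proof (cases t rule: transition_cases)
    case stutter
    with Suc.prems show ?thesis by (intro same) auto
  next
    case (invoke q c)
    then have "p \<noteq> q"
      using Suc.prems by (cases c) auto
    with invoke Suc.prems show ?thesis by (intro same) auto
  next
    case (collect q V)
    then have "p \<noteq> q"
      using Suc.prems by auto
    with collect Suc.prems show ?thesis by (intro same) auto
  next
    case (recheck q V)
    show ?thesis
    proof (cases "p = q")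
      case True
      obtain s where s: "invoked s t q" "collected s V t"
        using recheck stages[of t q] by auto
      then have len: "length V = m"
        using recheck by (simp add: collected_def)
      have x: "x = (Suc (phase V), None)" "mem t (phase V) \<noteq> None"
        using recheck Suc.prems True by (auto split: if_splits)
      have "outcome s t q x"
        using x phase_unstarted[OF s(2) len] phase_visible[OF s(2) len] recheck
        by (auto simp: less_Suc_eq)
      with s(1) True show ?thesis
        using outcome_Suc[of s t p x] invoked_mono[of s t p "Suc t"] by auto
    qed (use recheck Suc.prems in \<open>intro same; auto\<close>)
  next
    case (commit q V)
    show ?thesis
    proof (cases "p = q")
      case True
      obtain s u where s: "invoked s t q" "u < t" "verified s V u"
        using commit_verified commit by metis
      then have V: "collected s V u" "length V = m" "phase V < m" "mem u (phase V) = None"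
        by (auto simp: verified_def)
      have x: "x = stamp_of V"
        using commit Suc.prems True by auto
      have "outcome s (Suc t) q x"
      proof (cases "untouched V = {}")
        case True
        have "mem (Suc t) i \<noteq> None" if "i < Suc (phase V)" for i
          using that phase_visible[OF V(1,2), of i "Suc t"] commit s(2) True
          by (cases "i = phase V") (auto simp: entry_def target_def)
        with True phase_unstarted[OF V(1-3)] show ?thesis
          by (simp add: x stamp_of_def)
      next
        case False
        \<comment> \<open>The witness for \<open>w\<close> is \<open>Suc t\<close>, just after the
          write.\<close>
        have "owner w' i \<noteq> Some q" if "w' < Suc t" for w' i
          using unwritten[of t q w' i] commit that by auto
        moreover have "owner (Suc t) (target V) = Some q"
          using commit by (simp add: owner_def entry_def)
        ultimately have "\<exists>u w j. verified s V u \<and> u < w \<and> w \<le> Suc t \<and> j \<in> untouched V \<and>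
            owner w j = Some q \<and> (\<forall>w'<w. \<forall>i. owner w' i \<noteq> Some q)"
          using less_SucI[OF s(2)] s(3) target_untouched[OF False] by blast
        with False show ?thesis
          by (simp add: x stamp_of_def)
      qed
      with s(1) True show ?thesis
        using invoked_mono[of s t p "Suc t"] by auto
    qed (use commit Suc.prems in \<open>intro same; auto\<close>)
  next
    case (respond q y)
    with Suc.prems show ?thesis by (intro same) (auto split: if_splits)
  qed
qed

section \<open>Comparing two successive calls\<close>

text \<open>Here the second look pays off: register \<open>phase V\<close> was still empty when the
  leader's entry was read, so \<open>leader_snapshot\<close> applies to that entry.\<close>

lemma verified_leader:
  assumes "verified s V u" "0 < phase V"
  shows "snapshot (phase V - 1) (leader V)"
proof -
  define k where "k = phase V"
  have k: "0 < k" "k < m" "mem u k = None"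
    using assms by (auto simp: verified_def k_def)
  obtain \<tau> where \<tau>: "\<And>j. j < m \<Longrightarrow> \<tau> j \<le> u" "\<And>j. j < m \<Longrightarrow> V ! j = mem (\<tau> j) j"
    using verifiedE[OF assms(1)] by metis
  obtain q S where q: "V ! (k - 1) = Some (q, S)"
    using nth_less_phase[of "k - 1" V] k(1) by (auto simp: k_def)
  have "mem (\<tau> (k - 1)) k = None"
    using mem_None_before[of "\<tau> (k - 1)" u k] \<tau>(1)[of "k - 1"] k by auto
  moreover have "mem (\<tau> (k - 1)) (k - 1) = Some (q, S)"
    using q \<tau>(2)[of "k - 1"] k by simp
  ultimately have "snapshot (k - 1) S"
    using leader_snapshot[of "\<tau> (k - 1)" "k - 1" q S] k by simp
  then show ?thesis
    using q by (simp add: leader_def k_def[symmetric])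
qed

text \<open>Both records predate the phase. A register that has left them stays away by
  \<open>owner_between\<close>, and register \<open>j\<close>, overwritten by the first call, is new
  in the set.\<close>

lemma moved_grows:
  assumes 1: "outcome s t p (k, Some V)" and 2: "verified s' V' u'" and k: "phase V' = k" and "t \<le> s'"
  shows "moved (leader V) (leader V') V \<subset> moved (leader V) (leader V') V'"
proof -
  obtain u w j where V: "phase V = k" "verified s V u" and w: "u < w" "w \<le> t" "j \<in> untouched V"
    "owner w j = Some p" "\<And>w' i. w' < w \<Longrightarrow> owner w' i \<noteq> Some p"
    using 1 by auto
  have j: "Suc j < k" "writer (V ! j) = leader V ! j"
    using w(3) V by (auto simp: untouched_def)
  have km: "k < m"
    using V by (auto simp: verified_def)
  obtain \<tau> where \<tau>: "\<And>j. j < m \<Longrightarrow> \<tau> j \<le> u"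
    "\<And>j. j < m \<Longrightarrow> V ! j = mem (\<tau> j) j" "\<And>i j. i \<le> j \<Longrightarrow> j < m \<Longrightarrow> \<tau> j \<le> \<tau> i"
    using verifiedE[OF V(2)] by metis
  obtain \<tau>' where \<tau>': "\<And>j. j < m \<Longrightarrow> s' < \<tau>' j" "\<And>j. j < m \<Longrightarrow> V' ! j = mem (\<tau>' j) j"
    using verifiedE[OF 2] by metis
  have started: "mem (\<tau> (k - 1)) (k - 1) \<noteq> None"
    using nth_less_phase[of "k - 1" V] \<tau>(2)[of "k - 1"] V(1) j km by simp
  have own: "owner (\<tau> i) i = Some (writer (V ! i))" if "i < k" for i
    using owner_writer[of "\<tau> i" i] nth_less_phase[of i V] \<tau>(2)[of i] V(1) that km by simp
  have own': "owner (\<tau>' i) i = Some (writer (V' ! i))" if "i < k" for i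
    using owner_writer[of "\<tau>' i" i] nth_less_phase[of i V'] \<tau>'(2)[of i] k that km by simp
  \<comment> \<open>Every record of phase \<open>k\<close> was taken while register
    \<open>k - 1\<close> was empty, even the one seen by the later call.\<close>
  have old: "\<exists>\<rho><\<tau> (k - 1). owner \<rho> i = Some (L ! i)"
    if L: "L \<in> {leader V, leader V'}" and i: "Suc i < k" for L i
  proof -
    have "snapshot (k - 1) L"
      using L i verified_leader[OF V(2)] verified_leader[OF 2] V(1) k by auto
    then obtain \<rho> where "mem \<rho> (k - 1) = None" "owner \<rho> i = Some (L ! i)"
      using i unfolding snapshot_def by (metis less_diff_conv Suc_eq_plus1)
    with started show ?thesis
      using mem_None_less by blast
  qed
  have order: "\<tau> (k - 1) \<le> \<tau> i" "\<tau> i \<le> u" "u < \<tau>' i" if "i < k" for i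
    using \<tau>(1)[of i] \<tau>(3)[of i "k - 1"] \<tau>'(1)[of i] that km w \<open>t \<le> s'\<close> by auto
  have "i \<in> moved (leader V) (leader V') V'" if "i \<in> moved (leader V) (leader V') V" for i
  proof -
    have i: "Suc i < k" "writer (V ! i) \<notin> {leader V ! i, leader V' ! i}"
      using that V(1) by (auto simp: moved_def)
    have "writer (V' ! i) \<noteq> L ! i" if L: "L \<in> {leader V, leader V'}" for L
    proof
      assume "writer (V' ! i) = L ! i"
      then have "owner (\<tau>' i) i = Some (L ! i)"
        using own'[of i] i by simp
      moreover obtain \<rho> where "\<rho> < \<tau> (k - 1)" "owner \<rho> i = Some (L ! i)"
        using old[OF L i(1)] by blast
      ultimately have "owner (\<tau> i) i = Some (L ! i)"
        using owner_between[of \<rho> i "L ! i" "\<tau>' i" "\<tau> i"] order[of i] i by simp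
      with own[of i] i L show False by auto
    qed
    with i k show ?thesis by (auto simp: moved_def)
  qed
  moreover have "j \<notin> moved (leader V) (leader V') V"
    using j by (auto simp: moved_def)
  \<comment> \<open>A recorded writer present at \<open>\<rho>\<close> and at
    \<open>\<tau>' j\<close> would own register \<open>j\<close> also at \<open>w\<close>, where
    \<open>p\<close> does; but \<open>p\<close> owned nothing before \<open>w\<close>.\<close>
  moreover have "writer (V' ! j) \<noteq> L ! j" if L: "L \<in> {leader V, leader V'}" for L
  proof
    assume "writer (V' ! j) = L ! j"
    then have "owner (\<tau>' j) j = Some (L ! j)"
      using own'[of j] j by simp
    moreover obtain \<rho> where \<rho>: "\<rho> < \<tau> (k - 1)" "owner \<rho> j = Some (L ! j)"
      using old[OF L j(1)] by blast
    ultimately have "owner w j = Some (L ! j)"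
      using owner_between[of \<rho> j "L ! j" "\<tau>' j" w] order[of j] j w \<tau>'(1)[of j] km \<open>t \<le> s'\<close> by simp
    then have "owner \<rho> j = Some p"
      using \<rho>(2) w(4) by simp
    then show False
      using w(1) w(5)[of \<rho>] \<rho>(1) order[of j] j by simp
  qed
  then have "j \<in> moved (leader V) (leader V') V'"
    using j k by (auto simp: moved_def)
  ultimately show ?thesis by blast
qed

text \<open>All registers below the phase of the first stamp are filled when the second call starts,
  so phases cannot decrease; ties between two views are settled by
  \<open>moved_grows\<close>.\<close>

lemma outcome_precedes:
  assumes 1: "outcome s t p x" and 2: "outcome s' t' p' x'" and "t \<le> s'"
  shows "precedes x x' \<and> \<not> precedes x' x"
proof -
  obtain k y where x: "x = (k, y)" by (cases x)
  obtain k' y' where x': "x' = (k', y')" by (cases x')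
  have started: "mem s' i \<noteq> None" if i: "i < k" for i
  proof (cases y)
    case None
    with 1 x i show ?thesis using mem_persistent[OF \<open>t \<le> s'\<close>] by auto
  next
    case (Some V)
    then obtain u where "verified s V u" "u < t" "phase V = k"
      using 1 x by auto
    with i \<open>t \<le> s'\<close> show ?thesis
      using phase_visible[of s V u i s'] by (auto simp: verified_def)
  qed
  show ?thesis
  proof (cases y')
    case None
    then have "mem s' (k' - 1) = None" "0 < k'"
      using 2 x' by auto
    with started[of "k' - 1"] have "k < k'" by (cases "k' - 1 < k") auto
    with None x x' show ?thesis by (cases y) auto
  next
    case (Some V')
    then obtain u' where V': "verified s' V' u'" "phase V' = k'"
      using 2 x' by auto
    obtain \<tau> where \<tau>: "\<And>j. j < m \<Longrightarrow> s' < \<tau> j" "\<And>j. j < m \<Longrightarrow> V' ! j = mem (\<tau> j) j"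
      using verifiedE[OF V'(1)] by metis
    \<comment> \<open>Otherwise the nonexistent register \<open>m\<close> would be filled.\<close>
    have km: "k \<le> m"
      using started mem_out[of m s'] by (meson le_refl not_less)
    have "k \<le> k'"
      unfolding V'(2)[symmetric]
    proof (rule le_phaseI)
      show "k \<le> length V'"
        using km V' by (simp add: verified_def)
      show "V' ! i \<noteq> None" if "i < k" for i
        using mem_persistent[of s' "\<tau> i" i] started[OF that] \<tau>[of i] that km by auto
    qed
    show ?thesis
    proof (cases y)
      case None
      with Some x x' \<open>k \<le> k'\<close> show ?thesis by auto
    next
      case (Some V)
      show ?thesis
      proof (cases "k = k'")
        case True
        have "moved (leader V) (leader V') V \<subset> moved (leader V) (leader V') V'"
          using 1 x Some V' True \<open>t \<le> s'\<close> by (intro moved_grows[where k = k]) auto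
        \<comment> \<open>By this symmetry one strict inclusion settles both directions of the
          comparison.\<close>
        moreover have "moved (leader V') (leader V) = moved (leader V) (leader V')"
          by (auto simp: moved_def fun_eq_iff)
        ultimately show ?thesis
          using x x' Some \<open>y' = Some V'\<close> True by auto
      next
        case False
        with x x' Some \<open>y' = Some V'\<close> \<open>k \<le> k'\<close> show ?thesis by auto
      qed
    qed
  qed
qed

subsection \<open>Responses\<close>

lemma call_mode:
  assumes "i < t" "t \<le> length es" "es ! i = Invoke p c"
    and "\<And>j y. i < j \<Longrightarrow> j < t \<Longrightarrow> es ! j \<noteq> Respond p y"
  shows "active t p \<and> (if c = GetTS then (\<forall>b. mode t p \<noteq> Verdict b) else mode t p = initial_mode c)"
  using assms
proof (induction t)
  case 0
  then show ?case by simp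
next
  case (Suc t)
  show ?case
  proof (cases "i = t")
    case True
    with Suc.prems show ?thesis
      by (cases t rule: transition_cases) (auto)
  next
    case False
    with Suc have IH: "active t p"
      "if c = GetTS then (\<forall>b. mode t p \<noteq> Verdict b) else mode t p = initial_mode c"
      by auto
    have "es ! t \<noteq> Respond p y" for y
      using Suc.prems False by auto
    with IH Suc.prems show ?thesis
      by (cases t rule: transition_cases; cases c) (auto split: if_splits)
  qed
qed

lemma compare_response:
  assumes "completed_call es p (Compare t1 t2) i x k"
  shows "x = Truth (precedes (from_nat t1) (from_nat t2))"
proof -
  have k: "i < k" "k < length es" "es ! i = Invoke p (Compare t1 t2)" "es ! k = Respond p x"
    "\<And>j y. i < j \<Longrightarrow> j < k \<Longrightarrow> es ! j \<noteq> Respond p y"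
    using assms by (auto simp: completed_call_def)
  then have "mode k p = initial_mode (Compare t1 t2)"
    using call_mode[of i k p "Compare t1 t2"] by auto
  with k show ?thesis
    by (cases k rule: transition_cases) auto
qed

text \<open>The branches returning \<open>Stamp 0\<close> are ruled out by \<open>phase_less\<close>
  while collecting, and by \<open>target V \<le> phase V < m\<close> in
  \<open>Commit\<close>.\<close>

lemma getTS_response:
  assumes "n \<le> m * (m - 1) div 2" "0 < m" "completed_call es p GetTS i x k"
  obtains y where "x = Stamp (to_nat y)" "outcome i k p y"
proof -
  have k: "i < k" "k < length es" "es ! i = Invoke p GetTS" "es ! k = Respond p x"
    "\<And>j y. i < j \<Longrightarrow> j < k \<Longrightarrow> es ! j \<noteq> Respond p y"
    using assms(3) by (auto simp: completed_call_def)
  then have act: "active k p" "\<And>b. mode k p \<noteq> Verdict b"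
    using call_mode[of i k p GetTS] by auto
  have resp: "case mode k p of Collect V \<Rightarrow> m \<le> length V \<and> m \<le> phase V
       | Commit V \<Rightarrow> m \<le> target V | Answer y \<Rightarrow> x = Stamp (to_nat y) | Verdict b \<Rightarrow> x = Truth b"
    using k by (cases k rule: transition_cases) auto
  show ?thesis
  proof (cases "mode k p")
    case (Collect V)
    then obtain s where "collected s V k"
      using stages[OF act(1)] by auto
    with resp Collect phase_less[OF assms(1,2)] show ?thesis by fastforce
  next
    case (Commit V)
    then obtain s u where "verified s V u"
      using commit_verified[OF act(1)] by blast
    moreover have "target V \<le> phase V"
      using target_untouched[of V] by (cases "untouched V = {}") (auto simp: untouched_def target_def)
    ultimately show ?thesis
      using resp Commit by (simp add: verified_def)
  next
    case (Answer y)
    then obtain s where s: "invoked s k p" "outcome s k p y"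
      using answer_outcome[OF act(1)] by blast
    have "invoked i k p"
      using k by (simp add: invoked_def)
    with s(1) have "s = i"
      by (rule invoked_unique)
    with s resp Answer show ?thesis
      by (intro that) auto
  qed (use act in auto)
qed

end

section \<open>From runs to configuration sequences, and the choice of the number of
  registers\<close>

lemma run_sequence:
  assumes "run I n es C"
  obtains cfg where "cfg 0 = init_config I"
    "\<And>t. t < length es \<Longrightarrow> step I n (cfg t) (es ! t) (cfg (Suc t))"
    "\<And>t. length es \<le> t \<Longrightarrow> cfg t = C"
proof -
  have "\<exists>cfg. cfg 0 = init_config I \<and>
    (\<forall>t<length es. step I n (cfg t) (es ! t) (cfg (Suc t))) \<and> (\<forall>t\<ge>length es. cfg t = C)"
    using assms
  proof (induction rule: run.induct)
    case init
    then show ?case by (intro exI[of _ "\<lambda>t. init_config I"]) simp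
  next
    case (step es C e C')
    then obtain cfg where cfg: "cfg 0 = init_config I"
      "\<And>t. t < length es \<Longrightarrow> step I n (cfg t) (es ! t) (cfg (Suc t))"
      "\<And>t. length es \<le> t \<Longrightarrow> cfg t = C"
      by blast
    show ?case
      using cfg step.hyps(2)
      by (intro exI[of _ "\<lambda>t. if t \<le> length es then cfg t else C'"])
        (auto simp: nth_append less_Suc_eq)
  qed
  then show ?thesis
    using that by blast
qed

lemma object_implements:
  assumes "n \<le> m * (m - 1) div 2" "0 < m"
  shows "implements_one_shot_timestamp (object m) n"
  unfolding implements_one_shot_timestamp_def
proof (intro allI impI)
  fix es
  assume "one_shot_execution (object m) n es"
  then obtain C where "run (object m) n es C" and os: "one_shot es"
    by (auto simp: one_shot_execution_def)
  then obtain cfg where "cfg 0 = init_config (object m)"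
    "\<And>t. t < length es \<Longrightarrow> step (object m) n (cfg t) (es ! t) (cfg (Suc t))"
    "\<And>t. length es \<le> t \<Longrightarrow> cfg t = C"
    using run_sequence by metis
  with os interpret execution n m es cfg
    by unfold_locales auto
  have "returns_proper_results (universe (object m)) es"
    unfolding returns_proper_results_def
    using compare_response getTS_response[OF assms] by (metis UNIV_I object_simps(1))
  moreover have "respects_happens_before es"
    unfolding respects_happens_before_def
  proof (intro allI impI, elim conjE)
    fix p1 i1 t1 k1 p2 i2 t2 k2
    assume c: "completed_call es p1 GetTS i1 (Stamp t1) k1"
      "completed_call es p2 GetTS i2 (Stamp t2) k2" "k1 < i2"
    obtain y1 where y1: "t1 = to_nat y1" "outcome i1 k1 p1 y1"
      using getTS_response[OF assms c(1)] by auto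
    obtain y2 where y2: "t2 = to_nat y2" "outcome i2 k2 p2 y2"
      using getTS_response[OF assms c(2)] by auto
    have "precedes y1 y2 \<and> \<not> precedes y2 y1"
      using outcome_precedes[OF y1(2) y2(2)] c(3) by simp
    with y1 y2 show "(\<forall>q i x k. k2 < i \<and> completed_call es q (Compare t1 t2) i x k \<longrightarrow> x = Truth True) \<and>
        (\<forall>q i x k. k2 < i \<and> completed_call es q (Compare t2 t1) i x k \<longrightarrow> x = Truth False)"
      using compare_response by fastforce
  qed
  ultimately show "returns_proper_results (universe (object m)) es \<and> respects_happens_before es"
    by simp
qed

theorem theorem1p3:
  fixes n :: nat
  assumes "n \<ge> 1"
  shows "\<exists>I :: nat_implementation.
    uses_registers I n (2 * nat \<lceil>sqrt (real n)\<rceil>) \<and>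
    implements_one_shot_timestamp I n \<and>
    wait_free I n"
proof -
  define r where "r = nat \<lceil>sqrt (real n)\<rceil>"
  have r: "sqrt (real n) \<le> real r"
    unfolding r_def by (simp add: real_nat_ceiling_ge)
  then have "real n \<le> (real r)\<^sup>2"
    by (rule sqrt_le_D)
  then have n: "n \<le> r * r"
    by (metis of_nat_le_iff of_nat_mult power2_eq_square)
  with assms have "0 < r"
    by (cases r) auto
  \<comment> \<open>With \<open>m = 2 * r\<close> the capacity \<open>m * (m - 1) div 2\<close>
    equals \<open>r * (2 * r - 1)\<close>.\<close>
  then have "r * r \<le> r * (2 * r - 1)"
    by (intro mult_le_mono2) simp
  with n have "n \<le> r * (2 * r - 1)"
    by (rule order_trans)
  then have "n \<le> 2 * r * (2 * r - 1) div 2"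
    by (simp add: mult.assoc)
  then show ?thesis
    using object_uses_registers object_implements object_wait_free \<open>0 < r\<close>
    unfolding r_def[symmetric] by (intro exI[of _ "object (2 * r)"]) simp
qed

end
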